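(* Let $\mathfrak{r}_3$ be the complex Lie algebra on $\mathbb{C}^3$ with canonical basis $\{e_1,e_2,e_3\}$ and nonzero brackets $[e_1,e_2]=e_2$, $[e_1,e_3]=e_2+e_3$. Any hom-Lie algebra $(\mathfrak{r}_3,A)$ with $A$ a nilpotent operator is isomorphic to some hom-Lie algebra $\mathfrak{L}_2^i:=(\mathfrak{r}_3,A_i)$, where $A_0$ is the zero map and the matrices of the other $A_i$ with respect to the ordered basis $\{e_1,e_2,e_3\}$ are $$A_1=\begin{pmatrix}0&0&0\\1&0&0\\0&0&0\end{pmatrix},\quad A_2=\begin{pmatrix}0&0&0\\0&0&0\\1&0&0\end{pmatrix},$$ $$A_3(\lambda)=\begin{pmatrix}0&0&0\\0&0&\lambda\\0&0&0\end{pmatrix},\quad A_4(\lambda)=\begin{pmatrix}0&0&0\\0&0&0\\0&\lambda&0\end{pmatrix},$$ $$A_5(\lambda)=\begin{pmatrix}0&0&0\\0&0&\lambda\\1&0&0\end{pmatrix},\quad A_6(\lambda)=\begin{pmatrix}0&0&0\\1&0&0\\0&\lambda&0\end{pmatrix},$$ with $\lambda\in\mathbb{C}\setminus\{0\}$. Moreover, two hom-Lie algebras $(\mathfrak{r}_3,A_i)$ and $(\mathfrak{r}_3,A_j)$ in this list (including those with parameter $\lambda$) are isomorphic if and only if their twisting maps are equal, $A_i=A_j$.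
   Context: A complex hom-Lie algebra is a triple $(V,\cdot,A)$, where $V$ is a complex vector space, $\cdot$ is a skew-symmetric bilinear product on $V$, and $A:V\to V$ is a linear map (the twisting map) satisfying the hom-Jacobi identity $$\sum_{\sigma\in S_3}\operatorname{sign}(\sigma)\,Ax_{\sigma(1)}\cdot(x_{\sigma(2)}\cdot x_{\sigma(3)})=0\quad\text{for all }x_1,x_2,x_3\in V.$$ For a Lie algebra $\mathfrak{g}$, a hom-Lie algebra $(\mathfrak{g},A)$ is one whose product is the Lie bracket of $\mathfrak{g}$. An isomorphism of hom-Lie algebras $(V,\cdot,A)\to(U,\ast,B)$ is an invertible linear map $g:V\to U$ with $g(x\cdot y)=(gx)\ast(gy)$ for all $x,y\in V$ and $g\circ A=B\circ g$. In the matrix of a linear map, the $j$-th column is the coordinate vector of the image of $e_j$. *)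

theory Defs
  imports "HOL-Analysis.Analysis"
begin

definition skew_bilinear ::
    "(complex \<Rightarrow> 'v::ab_group_add \<Rightarrow> 'v) \<Rightarrow> ('v \<Rightarrow> 'v \<Rightarrow> 'v) \<Rightarrow> bool" where
  "skew_bilinear scl m \<longleftrightarrow>
     (\<forall>x. Vector_Spaces.linear scl scl (\<lambda>y. m x y)) \<and>
     (\<forall>y. Vector_Spaces.linear scl scl (\<lambda>x. m x y)) \<and>
     (\<forall>x y. m x y = - m y x)"

locale complex_lie_algebra = vector_space scl
  for scl :: "complex \<Rightarrow> 'v::ab_group_add \<Rightarrow> 'v" +
  fixes m :: "'v \<Rightarrow> 'v \<Rightarrow> 'v"
  assumes skew_bilinear: "skew_bilinear scl m"
    and jacobi: "m x (m y z) + m y (m z x) + m z (m x y) = 0"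

locale hom_lie_algebra = vector_space scl
  for scl :: "complex \<Rightarrow> 'v::ab_group_add \<Rightarrow> 'v" +
  fixes m :: "'v \<Rightarrow> 'v \<Rightarrow> 'v" and A :: "'v \<Rightarrow> 'v"
  assumes skew_bilinear: "skew_bilinear scl m"
    and linear_twist: "Vector_Spaces.linear scl scl A"
    and hom_jacobi: "\<And>x :: nat \<Rightarrow> 'v.
      (\<Sum>\<sigma> | \<sigma> permutes {1, 2, 3}.
         scl (of_int (sign \<sigma>)) (m (A (x (\<sigma> 1))) (m (x (\<sigma> 2)) (x (\<sigma> 3))))) = 0"

locale hom_lie_iso =
  V: hom_lie_algebra sV mV A + U: hom_lie_algebra sU mU B
  for sV :: "complex \<Rightarrow> 'v::ab_group_add \<Rightarrow> 'v" and mV A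
    and sU :: "complex \<Rightarrow> 'u::ab_group_add \<Rightarrow> 'u" and mU B +
  fixes g :: "'v \<Rightarrow> 'u"
  assumes linear_iso: "Vector_Spaces.linear sV sU g"
    and bij_iso: "bij g"
    and map_product: "g (mV x y) = mU (g x) (g y)"
    and intertwines: "g \<circ> A = B \<circ> g"

definition hom_lie_isomorphic where
  "hom_lie_isomorphic sV mV A sU mU B \<longleftrightarrow> (\<exists>g. hom_lie_iso sV mV A sU mU B g)"

definition nilpotent_map :: "('v::zero \<Rightarrow> 'v) \<Rightarrow> bool" where
  "nilpotent_map A \<longleftrightarrow> (\<exists>k. \<forall>x. (A ^^ k) x = 0)"

text \<open>The bilinear skew-symmetric extension of the brackets of basis vectors stated in
  \<open>r3_bracket_basis\<close> below.\<close>

definition r3_bracket :: "complex^3 \<Rightarrow> complex^3 \<Rightarrow> complex^3" where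
  "r3_bracket x y = vector
     [0,
      (x$1 * y$2 - x$2 * y$1) + (x$1 * y$3 - x$3 * y$1),
      x$1 * y$3 - x$3 * y$1]"

lemma r3_bracket_basis:
  "r3_bracket (axis 1 1) (axis 2 1) = axis 2 1"
  "r3_bracket (axis 1 1) (axis 3 1) = axis 2 1 + axis 3 1"
  "r3_bracket (axis 2 1) (axis 3 1) = 0"
  by (simp_all add: r3_bracket_def vec_eq_iff forall_3 axis_def)

lemma r3_skew_bilinear: "skew_bilinear (*s) r3_bracket"
  unfolding skew_bilinear_def r3_bracket_def
  by (auto simp: Vector_Spaces.linear_iff vec.vector_space_axioms vec_eq_iff forall_3 algebra_simps)

lemma r3_lie_algebra: "complex_lie_algebra (*s) r3_bracket"
proof unfold_locales
  show "skew_bilinear (*s) r3_bracket" by (rule r3_skew_bilinear)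
  show "r3_bracket x (r3_bracket y z) + r3_bracket y (r3_bracket z x)
      + r3_bracket z (r3_bracket x y) = 0" for x y z
    by (simp add: r3_bracket_def vec_eq_iff forall_3 algebra_simps)
qed

abbreviation r3_hom_lie :: "(complex^3 \<Rightarrow> complex^3) \<Rightarrow> bool" where
  "r3_hom_lie A \<equiv> hom_lie_algebra (*s) r3_bracket A"

abbreviation r3_isomorphic ::
    "(complex^3 \<Rightarrow> complex^3) \<Rightarrow> (complex^3 \<Rightarrow> complex^3) \<Rightarrow> bool" where
  "r3_isomorphic A B \<equiv> hom_lie_isomorphic (*s) r3_bracket A (*s) r3_bracket B"

definition A0 :: "complex^3^3" where
  "A0 = vector [vector [0, 0, 0], vector [0, 0, 0], vector [0, 0, 0]]"

definition A1 :: "complex^3^3" where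
  "A1 = vector [vector [0, 0, 0], vector [1, 0, 0], vector [0, 0, 0]]"

definition A2 :: "complex^3^3" where
  "A2 = vector [vector [0, 0, 0], vector [0, 0, 0], vector [1, 0, 0]]"

definition A3 :: "complex \<Rightarrow> complex^3^3" where
  "A3 l = vector [vector [0, 0, 0], vector [0, 0, l], vector [0, 0, 0]]"

definition A4 :: "complex \<Rightarrow> complex^3^3" where
  "A4 l = vector [vector [0, 0, 0], vector [0, 0, 0], vector [0, l, 0]]"

definition A5 :: "complex \<Rightarrow> complex^3^3" where
  "A5 l = vector [vector [0, 0, 0], vector [0, 0, l], vector [1, 0, 0]]"

definition A6 :: "complex \<Rightarrow> complex^3^3" where
  "A6 l = vector [vector [0, 0, 0], vector [1, 0, 0], vector [0, l, 0]]"

definition L2_twists :: "(complex^3 \<Rightarrow> complex^3) set" where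
  "L2_twists = (*v) ` ({A0, A1, A2} \<union>
     (\<Union>l \<in> UNIV - {0}. {A3 l, A4 l, A5 l, A6 l}))"

end

theory Submission
  imports Defs
begin

text \<open>The statement reduces to a computation with \<open>2 \<times> 2\<close> blocks. The only instance of the
  hom-Jacobi identity that says anything on \<open>r3\<close> is the one for the three basis vectors, and it says
  that the first row of the twisting map vanishes off the diagonal (\<open>r3_hom_lie_iff\<close>).
  Nilpotency then kills the diagonal entry and forces the lower right block \<open>N\<close> to have trace and
  determinant zero (\<open>nilpotent_lower_block\<close>). So a nilpotent twist is a pair: the vector
  \<open>w = A e\<^sub>1\<close> in the derived algebra \<open>\<langle>e\<^sub>2, e\<^sub>3\<rangle>\<close>, and a nilpotent \<open>N\<close> acting on that plane.

  An automorphism of \<open>r3\<close> sends \<open>e\<^sub>1\<close> to \<open>e\<^sub>1 + z\<close> with \<open>z\<close> in the plane, and acts on the plane by some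
  \<open>P = p + q E\<^sub>1\<^sub>2\<close>, because it has to commute with the Jordan block \<open>ad e\<^sub>1\<close>
  (\<open>r3_automorphism_matrix\<close>). It carries \<open>(w, N)\<close> to \<open>(w', N')\<close> exactly when \<open>P N = N' P\<close> and
  \<open>P w = w' + N' z\<close> (\<open>twist_isomorphic_iff\<close>). Since \<open>P\<close> is triangular with equal diagonal entries, the
  (2,1) entry \<open>c\<close> of \<open>N\<close> is invariant. If \<open>c \<noteq> 0\<close>, a choice of \<open>q\<close> makes \<open>N' = c E\<^sub>2\<^sub>1\<close>, then \<open>z\<close> clears the
  \<open>e\<^sub>3\<close> part of \<open>w\<close>, and \<open>p\<close> scales its \<open>e\<^sub>2\<close> part to 0 or 1. If \<open>c = 0\<close>, then \<open>N = b E\<^sub>1\<^sub>2\<close> commutes with \<open>P\<close>,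
  so \<open>b\<close> is invariant; for \<open>b \<noteq> 0\<close> the \<open>e\<^sub>2\<close> part of \<open>w\<close> is cleared by \<open>z\<close> and the \<open>e\<^sub>3\<close> part is scaled,
  and for \<open>b = 0\<close> the orbits of \<open>P\<close> on the plane are represented by \<open>0\<close>, \<open>e\<^sub>2\<close>, \<open>e\<^sub>3\<close>. These are the listed
  maps (\<open>nilpotent_twist_normal_form\<close>). Two of them are never isomorphic: \<open>b\<close> and \<open>c\<close> agree by invariance,
  and what is left of \<open>w\<close> is a coordinate with value 0 or 1 that can only be scaled by \<open>p \<noteq> 0\<close>.\<close>

section \<open>The hom-Jacobi identity on \<open>r3\<close>\<close>

lemma signed_sum_permutations_3:
  fixes f :: "nat \<Rightarrow> nat \<Rightarrow> nat \<Rightarrow> complex^3"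
  shows "(\<Sum>\<sigma> | \<sigma> permutes {1, 2, 3}. of_int (sign \<sigma>) *s f (\<sigma> 1) (\<sigma> 2) (\<sigma> 3))
    = f 1 2 3 - f 1 3 2 - f 2 1 3 + f 2 3 1 + f 3 1 2 - f 3 2 1"
proof -
  have f123: "finite {2::nat, 3}" "1 \<notin> {2::nat, 3}" and f23: "finite {3::nat}" "2 \<notin> {3::nat}"
    by auto
  show ?thesis
    unfolding sum_over_permutations_insert[OF f123] sum_over_permutations_insert[OF f23]
      permutes_sing
    by (simp add: sign_swap_id permutation_swap_id sign_compose sign_id transpose_def
        permutation_id permutation_compose)
qed

text \<open>Only the triple \<open>e\<^sub>1, e\<^sub>2, e\<^sub>3\<close> matters, because the expression is alternating and trilinear in three
  vectors of a three-dimensional space. On that triple it equals, up to a factor 2,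
  \<open>- [A e\<^sub>2, e\<^sub>2 + e\<^sub>3] + [A e\<^sub>3, e\<^sub>2]\<close>, with coordinates \<open>M\<^sub>1\<^sub>3 - 2 M\<^sub>1\<^sub>2\<close> and \<open>- M\<^sub>1\<^sub>2\<close>.\<close>

lemma r3_hom_lie_iff:
  fixes M :: "complex^3^3"
  shows "r3_hom_lie ((*v) M) \<longleftrightarrow> M$1$2 = 0 \<and> M$1$3 = 0"
proof
  assume "r3_hom_lie ((*v) M)"
  then interpret hom_lie_algebra "(*s)" r3_bracket "(*v) M" .
  define x :: "nat \<Rightarrow> complex^3"
    where "x n = (if n = 1 then axis 1 1 else if n = 2 then axis 2 1 else axis 3 1)" for n
  note J = hom_jacobi[of x, unfolded signed_sum_permutations_3[of "\<lambda>i j k. r3_bracket (M *v x i) (r3_bracket (x j) (x k))"]]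
  have "M$1$3 - 2 * M$1$2 = 0 \<and> M$1$2 = 0"
    using J
    by (simp add: x_def r3_bracket_def vec_eq_iff forall_3 matrix_vector_mult_def sum_3 axis_def)
  then show "M$1$2 = 0 \<and> M$1$3 = 0" by simp
next
  assume M: "M$1$2 = 0 \<and> M$1$3 = 0"
  show "r3_hom_lie ((*v) M)"
  proof unfold_locales
    show "skew_bilinear (*s) r3_bracket" by (rule r3_skew_bilinear)
    fix x :: "nat \<Rightarrow> complex^3"
    show "(\<Sum>\<sigma> | \<sigma> permutes {1, 2, 3}. of_int (sign \<sigma>) *s
        r3_bracket (M *v x (\<sigma> 1)) (r3_bracket (x (\<sigma> 2)) (x (\<sigma> 3)))) = 0"
      unfolding signed_sum_permutations_3[of "\<lambda>i j k. r3_bracket (M *v x i) (r3_bracket (x j) (x k))"]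
      using M
      by (simp add: r3_bracket_def vec_eq_iff forall_3 matrix_vector_mult_def sum_3 algebra_simps)
  qed
qed

section \<open>Automorphisms of \<open>r3\<close>\<close>

definition aut_matrix :: "complex \<Rightarrow> complex \<Rightarrow> complex \<Rightarrow> complex \<Rightarrow> complex^3^3" where
  "aut_matrix p q s t = vector [vector [1, 0, 0], vector [s, p, q], vector [t, 0, p]]"

lemma aut_matrix_bij:
  assumes "p \<noteq> 0"
  shows "bij ((*v) (aut_matrix p q s t))"
proof -
  have "det (aut_matrix p q s t) \<noteq> 0"
    using assms by (simp add: aut_matrix_def det_3)
  then show ?thesis
    by (simp add: invertible_det_nz[symmetric] invertible_eq_bij)
qed

lemma aut_matrix_bracket:
  "aut_matrix p q s t *v r3_bracket x y
    = r3_bracket (aut_matrix p q s t *v x) (aut_matrix p q s t *v y)"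
  by (simp add: aut_matrix_def r3_bracket_def vec_eq_iff forall_3 matrix_vector_mult_def sum_3
      algebra_simps)

text \<open>The first coordinate of a bracket vanishes, so the first row of \<open>G\<close> is \<open>(G\<^sub>1\<^sub>1, 0, 0)\<close>, and on the
  derived algebra \<open>G\<close> satisfies \<open>G J = G\<^sub>1\<^sub>1 J G\<close> for the Jordan block \<open>J\<close> of \<open>ad e\<^sub>1\<close>. Comparing the
  eigenvalues of \<open>J\<close> and \<open>G\<^sub>1\<^sub>1 J\<close> gives \<open>G\<^sub>1\<^sub>1 = 1\<close>; the rest is the commutant of \<open>J\<close>.\<close>

lemma r3_automorphism_matrix:
  fixes G :: "complex^3^3"
  assumes inj: "inj ((*v) G)"
    and hom: "\<And>x y. G *v r3_bracket x y = r3_bracket (G *v x) (G *v y)"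
  obtains p q s t where "p \<noteq> 0" "G = aut_matrix p q s t"
proof -
  have h2: "G *v r3_bracket (axis 1 1) (axis 2 1)
      = r3_bracket (G *v axis 1 1) (G *v axis 2 1)"
    and h3: "G *v r3_bracket (axis 1 1) (axis 3 1)
      = r3_bracket (G *v axis 1 1) (G *v axis 3 1)"
    by (rule hom)+
  have r12: "G$1$2 = 0"
    using h2 by (simp add: r3_bracket_def vec_eq_iff forall_3 matrix_vector_mult_def sum_3 axis_def)
  have r13: "G$1$3 = 0"
    using h3 r12
    by (simp add: r3_bracket_def vec_eq_iff forall_3 matrix_vector_mult_def sum_3 axis_def)
  have c2: "G$2$2 = G$1$1 * (G$2$2 + G$3$2)" "G$3$2 = G$1$1 * G$3$2"
    using h2 r12
    by (simp_all add: r3_bracket_def vec_eq_iff forall_3 matrix_vector_mult_def sum_3 axis_def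
        algebra_simps)
  have c3: "G$2$2 + G$2$3 = G$1$1 * (G$2$3 + G$3$3)" "G$3$2 + G$3$3 = G$1$1 * G$3$3"
    using h3 r12 r13
    by (simp_all add: r3_bracket_def vec_eq_iff forall_3 matrix_vector_mult_def sum_3 axis_def
        algebra_simps)
  have r32: "G$3$2 = 0"
    using c2 by (cases "G$1$1 = 1") auto
  have nz: "G$2$2 \<noteq> 0"
  proof
    assume "G$2$2 = 0"
    then have "G *v axis 2 1 = G *v 0"
      using r12 r32
      by (simp add: vec_eq_iff forall_3 matrix_vector_mult_def sum_3 axis_def)
    then have "axis 2 1 = (0 :: complex^3)"
      using inj by (blast dest: injD)
    then show False by simp
  qed
  have r11: "G$1$1 = 1"
    using c2 r32 nz by simp
  have r33: "G$3$3 = G$2$2"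
    using c3 r11 by simp
  have "G = aut_matrix (G$2$2) (G$2$3) (G$2$1) (G$3$1)"
    using r11 r12 r13 r32 r33 by (simp add: aut_matrix_def vec_eq_iff forall_3)
  with nz show thesis by (rule that)
qed

lemma r3_isomorphic_iff:
  fixes M N :: "complex^3^3"
  shows "r3_isomorphic ((*v) M) ((*v) N) \<longleftrightarrow>
    r3_hom_lie ((*v) M) \<and> r3_hom_lie ((*v) N) \<and>
    (\<exists>p q s t. p \<noteq> 0 \<and> aut_matrix p q s t ** M = N ** aut_matrix p q s t)"
proof
  assume "r3_isomorphic ((*v) M) ((*v) N)"
  then obtain g where "hom_lie_iso (*s) r3_bracket ((*v) M) (*s) r3_bracket ((*v) N) g"
    unfolding hom_lie_isomorphic_def by blast
  then interpret g: hom_lie_iso "(*s)" r3_bracket "(*v) M" "(*s)" r3_bracket "(*v) N" g .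
  have G: "matrix g *v x = g x" for x
    by (rule matrix_works[OF g.linear_iso])
  obtain p q s t where "p \<noteq> 0" and eq: "matrix g = aut_matrix p q s t"
    by (rule r3_automorphism_matrix[of "matrix g"])
      (use g.bij_iso in \<open>simp_all add: G g.map_product bij_is_inj cong: inj_on_cong\<close>)
  moreover have "matrix g ** M = N ** matrix g"
    by (rule matrix_eq[THEN iffD2])
      (simp add: matrix_vector_mul_assoc[symmetric] G fun_cong[OF g.intertwines, simplified])
  ultimately show "r3_hom_lie ((*v) M) \<and> r3_hom_lie ((*v) N) \<and>
      (\<exists>p q s t. p \<noteq> 0 \<and> aut_matrix p q s t ** M = N ** aut_matrix p q s t)"
    using g.V.hom_lie_algebra_axioms g.U.hom_lie_algebra_axioms by metis
next
  assume "r3_hom_lie ((*v) M) \<and> r3_hom_lie ((*v) N) \<and>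
      (\<exists>p q s t. p \<noteq> 0 \<and> aut_matrix p q s t ** M = N ** aut_matrix p q s t)"
  then obtain p q s t where M: "r3_hom_lie ((*v) M)" and N: "r3_hom_lie ((*v) N)"
    and p: "p \<noteq> 0" and eq: "aut_matrix p q s t ** M = N ** aut_matrix p q s t"
    by blast
  have "hom_lie_iso (*s) r3_bracket ((*v) M) (*s) r3_bracket ((*v) N) ((*v) (aut_matrix p q s t))"
    unfolding hom_lie_iso_def hom_lie_iso_axioms_def
    using M N aut_matrix_bij[OF p] aut_matrix_bracket eq
    by (auto simp: fun_eq_iff matrix_vector_mul_assoc matrix_vector_mul_linear_gen)
  then show "r3_isomorphic ((*v) M) ((*v) N)"
    unfolding hom_lie_isomorphic_def by blast
qed

section \<open>Twists with zero first row\<close>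

definition twist :: "complex \<Rightarrow> complex \<Rightarrow> complex \<Rightarrow> complex \<Rightarrow> complex \<Rightarrow> complex \<Rightarrow> complex^3^3" where
  "twist u v a b c d = vector [vector [0, 0, 0], vector [u, a, b], vector [v, c, d]]"

lemma r3_hom_lie_twist: "r3_hom_lie ((*v) (twist u v a b c d))"
  by (simp add: r3_hom_lie_iff twist_def)

lemma twist_isomorphic_iff:
  "r3_isomorphic ((*v) (twist u v a b c d)) ((*v) (twist u' v' a' b' c' d')) \<longleftrightarrow>
    (\<exists>p q s t. p \<noteq> 0 \<and>
      p * u + q * v = u' + a' * s + b' * t \<and> p * v = v' + c' * s + d' * t \<and>
      p * a + q * c = a' * p \<and> p * b + q * d = a' * q + b' * p \<and>
      p * c = c' * p \<and> p * d = c' * q + d' * p)"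
proof -
  have "aut_matrix p q s t ** twist u v a b c d = twist u' v' a' b' c' d' ** aut_matrix p q s t \<longleftrightarrow>
      p * u + q * v = u' + a' * s + b' * t \<and> p * v = v' + c' * s + d' * t \<and>
      p * a + q * c = a' * p \<and> p * b + q * d = a' * q + b' * p \<and>
      p * c = c' * p \<and> p * d = c' * q + d' * p" for p q s t
    by (auto simp: aut_matrix_def twist_def vec_eq_iff forall_3 matrix_matrix_mult_def sum_3)
  then show ?thesis
    by (simp add: r3_isomorphic_iff r3_hom_lie_twist)
qed

lemma L2_twist_matrices:
  "A0 = twist 0 0 0 0 0 0" "A1 = twist 1 0 0 0 0 0" "A2 = twist 0 1 0 0 0 0"
  "A3 l = twist 0 0 0 l 0 0" "A4 l = twist 0 0 0 0 l 0"
  "A5 l = twist 0 1 0 l 0 0" "A6 l = twist 1 0 0 0 l 0"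
  by (simp_all add: A0_def A1_def A2_def A3_def A4_def A5_def A6_def twist_def)

section \<open>Nilpotent twists\<close>

lemma nilpotent_map_eigenvalue:
  fixes M :: "complex^'n^'n"
  assumes nil: "nilpotent_map ((*v) M)" and det: "det (mat r - M) = 0"
  shows "r = 0"
proof -
  have "\<not> invertible (mat r - M)"
    using det by (simp add: invertible_det_nz)
  then obtain x where x: "x \<noteq> 0" and "(mat r - M) *v x = 0"
    using matrix_left_invertible_ker[of "mat r - M"] invertible_left_inverse by blast
  moreover have "mat r *v x = r *s x"
    by (simp add: vec_eq_iff matrix_vector_mult_def mat_def if_distrib[of "\<lambda>y. y * _"] cong: if_cong)
  ultimately have ev: "M *v x = r *s x"
    by (simp add: matrix_vector_mult_diff_rdistrib)
  have pow: "((*v) M ^^ k) x = (r ^ k) *s x" for k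
    by (induction k)
      (simp_all add: vector_scalar_commute ev vector_smult_assoc mult.commute)
  obtain k where "((*v) M ^^ k) x = 0"
    using nil unfolding nilpotent_map_def by blast
  then have "r ^ k = 0"
    using x by (simp add: pow vec.scale_eq_0_iff)
  then show ?thesis by simp
qed

text \<open>With first row \<open>(M\<^sub>1\<^sub>1, 0, 0)\<close> the characteristic polynomial factors, so \<open>M\<^sub>1\<^sub>1\<close> and both roots
  of the quadratic of the lower block are eigenvalues. The trace and determinant of the block are
  the sum and product of these two roots.\<close>

lemma nilpotent_lower_block:
  fixes M :: "complex^3^3"
  assumes nil: "nilpotent_map ((*v) M)" and row: "M$1$2 = 0" "M$1$3 = 0"
  obtains u v a b c where "M = twist u v a b c (- a)" "a * a + b * c = 0"
proof -
  have det: "det (mat r - M)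
      = (r - M$1$1) * ((r - M$2$2) * (r - M$3$3) - M$2$3 * M$3$2)" for r
    using row by (simp add: det_3 mat_def algebra_simps)
  have zero11: "M$1$1 = 0"
    by (rule nilpotent_map_eigenvalue[OF nil]) (simp add: det)
  define T where "T = M$2$2 + M$3$3"
  define D where "D = M$2$2 * M$3$3 - M$2$3 * M$3$2"
  define w where "w = csqrt (T * T - 4 * D)"
  have w: "w * w = T * T - 4 * D"
    using power2_csqrt[of "T * T - 4 * D"] by (simp add: w_def power2_eq_square)
  have factor: "(r - M$2$2) * (r - M$3$3) - M$2$3 * M$3$2 = r * r - T * r + D" for r
    by (simp add: T_def D_def algebra_simps)
  have quadratic: "r * r - T * r + D = 0" if "2 * r = T + w \<or> 2 * r = T - w" for r
  proof -
    have "4 * (r * r - T * r + D) = 0"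
      using that w by algebra
    then show ?thesis
      by (simp only: mult_eq_0_iff) simp
  qed
  have root: "r = 0" if "2 * r = T + w \<or> 2 * r = T - w" for r
    by (rule nilpotent_map_eigenvalue[OF nil]) (simp add: det factor quadratic[OF that])
  have "T + w = 0" "T - w = 0"
    using root[of "(T + w) / 2"] root[of "(T - w) / 2"] by simp_all
  then have T: "T = 0" and "w = 0" by simp_all
  then have D: "D = 0" using w by simp
  have d: "M$3$3 = - M$2$2"
    using T by (simp add: T_def add_eq_0_iff)
  have "M = twist (M$2$1) (M$3$1) (M$2$2) (M$2$3) (M$3$2) (- M$2$2)"
    using row zero11 d by (simp add: twist_def vec_eq_iff forall_3)
  moreover have "M$2$2 * M$2$2 + M$2$3 * M$3$2 = - D"
    by (simp add: D_def d)
  then have "M$2$2 * M$2$2 + M$2$3 * M$3$2 = 0"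
    by (simp add: D)
  ultimately show thesis by (rule that)
qed

section \<open>Normal forms and their separation\<close>

lemma L2_twists_cases:
  assumes "B \<in> L2_twists"
  obtains "B = (*v) A0" | "B = (*v) A1" | "B = (*v) A2"
  | l where "l \<noteq> 0" "B = (*v) (A3 l)" | l where "l \<noteq> 0" "B = (*v) (A4 l)"
  | l where "l \<noteq> 0" "B = (*v) (A5 l)" | l where "l \<noteq> 0" "B = (*v) (A6 l)"
  using assms unfolding L2_twists_def by auto

lemma L2_twists_memberI:
  "(*v) A0 \<in> L2_twists" "(*v) A1 \<in> L2_twists" "(*v) A2 \<in> L2_twists"
  "l \<noteq> 0 \<Longrightarrow> (*v) (A3 l) \<in> L2_twists" "l \<noteq> 0 \<Longrightarrow> (*v) (A4 l) \<in> L2_twists"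
  "l \<noteq> 0 \<Longrightarrow> (*v) (A5 l) \<in> L2_twists" "l \<noteq> 0 \<Longrightarrow> (*v) (A6 l) \<in> L2_twists"
  unfolding L2_twists_def by auto

text \<open>The normal form that the list shares; it is all that the separation of the orbits uses.\<close>

lemma L2_twists_is_twist:
  assumes "B \<in> L2_twists"
  obtains u v b c where "B = (*v) (twist u v 0 b c 0)" "u = 0 \<or> u = 1" "v = 0 \<or> v = 1"
    "b \<noteq> 0 \<Longrightarrow> u = 0" "c \<noteq> 0 \<Longrightarrow> v = 0" "u = 0 \<or> v = 0"
  using assms
proof (cases rule: L2_twists_cases)
  case 1 then show thesis by (intro that[of 0 0 0 0]) (simp_all add: L2_twist_matrices)
next
  case 2 then show thesis by (intro that[of 1 0 0 0]) (simp_all add: L2_twist_matrices)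
next
  case 3 then show thesis by (intro that[of 0 1 0 0]) (simp_all add: L2_twist_matrices)
next
  case (4 l) then show thesis by (intro that[of 0 0 l 0]) (simp_all add: L2_twist_matrices)
next
  case (5 l) then show thesis by (intro that[of 0 0 0 l]) (simp_all add: L2_twist_matrices)
next
  case (6 l) then show thesis by (intro that[of 0 1 l 0]) (simp_all add: L2_twist_matrices)
next
  case (7 l) then show thesis by (intro that[of 1 0 0 l]) (simp_all add: L2_twist_matrices)
qed

lemma twist_isomorphicI:
  assumes "p \<noteq> 0"
    and "p * u + q * v = u' + a' * s + b' * t" "p * v = v' + c' * s + d' * t"
    and "p * a + q * c = a' * p" "p * b + q * d = a' * q + b' * p"
    and "p * c = c' * p" "p * d = c' * q + d' * p"
  shows "r3_isomorphic ((*v) (twist u v a b c d)) ((*v) (twist u' v' a' b' c' d'))"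
  unfolding twist_isomorphic_iff using assms by blast

text \<open>The (2,1) entry \<open>c\<close> of the block decides the shape: it is zero exactly when the block
  preserves the line of \<open>e\<^sub>2\<close>, the only eigenline of \<open>ad e\<^sub>1\<close> in the plane. In each case \<open>q\<close> and the
  translation \<open>s, t\<close> clear what they can, and \<open>p\<close> is the reciprocal of the surviving coordinate of
  \<open>A e\<^sub>1\<close> if there is one.\<close>

lemma nilpotent_twist_normal_form:
  assumes block: "a * a + b * c = 0"
  shows "\<exists>B \<in> L2_twists. r3_isomorphic ((*v) (twist u v a b c (- a))) B"
proof (cases "c = 0")
  case c: True
  then have a: "a = 0" using block by simp
  show ?thesis
  proof (cases "b = 0")
    case b: True
    consider "u = 0" "v = 0" | "u \<noteq> 0" "v = 0" | "v \<noteq> 0" by blast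
    then show ?thesis
    proof cases
      case 1
      then have "r3_isomorphic ((*v) (twist u v a b c (- a))) ((*v) A0)"
        unfolding L2_twist_matrices using a b c
        by (intro twist_isomorphicI[where p = 1 and q = 0 and s = 0 and t = 0]) simp_all
      then show ?thesis using L2_twists_memberI by blast
    next
      case 2
      then have "r3_isomorphic ((*v) (twist u v a b c (- a))) ((*v) A1)"
        unfolding L2_twist_matrices using a b c
        by (intro twist_isomorphicI[where p = "1 / u" and q = 0 and s = 0 and t = 0]) simp_all
      then show ?thesis using L2_twists_memberI by blast
    next
      case 3
      then have "r3_isomorphic ((*v) (twist u v a b c (- a))) ((*v) A2)"
        unfolding L2_twist_matrices using a b c
        by (intro twist_isomorphicI[where p = "1 / v" and q = "- u / (v * v)" and s = 0 and t = 0])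
          simp_all
      then show ?thesis using L2_twists_memberI by blast
    qed
  next
    case b: False
    show ?thesis
    proof (cases "v = 0")
      case True
      then have "r3_isomorphic ((*v) (twist u v a b c (- a))) ((*v) (A3 b))"
        unfolding L2_twist_matrices using a b c
        by (intro twist_isomorphicI[where p = 1 and q = 0 and s = 0 and t = "u / b"]) simp_all
      then show ?thesis using L2_twists_memberI b by blast
    next
      case False
      then have "r3_isomorphic ((*v) (twist u v a b c (- a))) ((*v) (A5 b))"
        unfolding L2_twist_matrices using a b c
        by (intro twist_isomorphicI[where p = "1 / v" and q = 0 and s = 0 and t = "u / (v * b)"])
          simp_all
      then show ?thesis using L2_twists_memberI b by blast
    qed
  qed
next
  case c: False
  \<comment> \<open>The shear \<open>q = - p a / c\<close> moves the kernel of the block, spanned by \<open>(a, c)\<close>, onto the line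
    of \<open>e\<^sub>3\<close>; it turns the \<open>e\<^sub>2\<close> coordinate of \<open>A e\<^sub>1\<close> into \<open>p k\<close>.\<close>
  define k where "k = u - a * v / c"
  have b: "b = - a * a / c"
    using block c by (simp add: field_simps add_eq_0_iff)
  show ?thesis
  proof (cases "k = 0")
    case True
    then have "r3_isomorphic ((*v) (twist u v a b c (- a))) ((*v) (A4 c))"
      unfolding L2_twist_matrices using b c
      by (intro twist_isomorphicI[where p = 1 and q = "- a / c" and s = "v / c" and t = 0])
        (simp_all add: k_def)
    then show ?thesis using L2_twists_memberI c by blast
  next
    case False
    have "(u - a * v / c) / k = 1"
      using False by (simp flip: k_def)
    then have "u / k - a * v / (c * k) = 1"
      by (simp add: diff_divide_distrib)
    then have "r3_isomorphic ((*v) (twist u v a b c (- a))) ((*v) (A6 c))"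
      unfolding L2_twist_matrices using b c False
      by (intro twist_isomorphicI[where p = "1 / k" and q = "- a / (c * k)" and s = "v / (c * k)"
            and t = 0])
        simp_all
    then show ?thesis using L2_twists_memberI c by blast
  qed
qed

lemma r3_nilpotent_classification:
  assumes hom: "r3_hom_lie A" and nil: "nilpotent_map A"
  shows "\<exists>B \<in> L2_twists. r3_isomorphic A B"
proof -
  interpret hom_lie_algebra "(*s)" r3_bracket A by (rule hom)
  obtain M where A: "A = (*v) M"
    using matrix_works[OF linear_twist] by (metis ext)
  have "M$1$2 = 0" "M$1$3 = 0"
    using hom by (simp_all add: A r3_hom_lie_iff)
  then obtain u v a b c where "M = twist u v a b c (- a)" and "a * a + b * c = 0"
    by (rule nilpotent_lower_block[OF nil[unfolded A]])
  then show ?thesis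
    by (simp add: A nilpotent_twist_normal_form)
qed

text \<open>The order of comparison matters: with \<open>b\<close> and \<open>c\<close> known to agree, the \<open>e\<^sub>3\<close> coordinate \<open>v\<close> is
  either forced to vanish or only scaled by \<open>p\<close>, and only where \<open>b = v = 0\<close> does the same apply to \<open>u\<close>;
  otherwise the normal form already has \<open>u = 0\<close>.\<close>

lemma L2_twists_isomorphic_imp_eq:
  assumes B: "B \<in> L2_twists" and C: "C \<in> L2_twists" and iso: "r3_isomorphic B C"
  shows "B = C"
proof -
  obtain u v b c where B: "B = (*v) (twist u v 0 b c 0)"
    and n: "u = 0 \<or> u = 1" "v = 0 \<or> v = 1" "b \<noteq> 0 \<Longrightarrow> u = 0" "c \<noteq> 0 \<Longrightarrow> v = 0" "u = 0 \<or> v = 0"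
    using L2_twists_is_twist[OF B] by blast
  obtain u' v' b' c' where C: "C = (*v) (twist u' v' 0 b' c' 0)"
    and n': "u' = 0 \<or> u' = 1" "v' = 0 \<or> v' = 1" "b' \<noteq> 0 \<Longrightarrow> u' = 0" "c' \<noteq> 0 \<Longrightarrow> v' = 0"
      "u' = 0 \<or> v' = 0"
    using L2_twists_is_twist[OF C] by blast
  obtain p q s t where p: "p \<noteq> 0"
    and u: "p * u + q * v = u' + b' * t" and v: "p * v = v' + c' * s"
    and b: "b' = b" and c: "c' = c"
    using iso unfolding B C twist_isomorphic_iff by auto
  have v_eq: "v' = v"
    using v c n n' p by (cases "c = 0") auto
  have u_eq: "u' = u"
  proof (cases "b = 0 \<and> v = 0")
    case True
    then have "p * u = u'" using u b by simp
    then show ?thesis using n(1) n'(1) p by auto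
  next
    case False
    then show ?thesis using n n' b v_eq by auto
  qed
  show ?thesis
    by (simp add: B C b c u_eq v_eq)
qed

theorem proposition3p9:
  "(\<forall>B \<in> L2_twists. r3_hom_lie B) \<and>
   (\<forall>A. r3_hom_lie A \<and> nilpotent_map A \<longrightarrow> (\<exists>B \<in> L2_twists. r3_isomorphic A B)) \<and>
   (\<forall>B \<in> L2_twists. \<forall>C \<in> L2_twists. r3_isomorphic B C \<longleftrightarrow> B = C)"
proof (intro conjI ballI allI impI iffI)
  fix B assume "B \<in> L2_twists"
  then show "r3_hom_lie B"
    by (rule L2_twists_is_twist) (simp add: r3_hom_lie_twist)
next
  fix A assume "r3_hom_lie A \<and> nilpotent_map A"
  then show "\<exists>B \<in> L2_twists. r3_isomorphic A B"
    using r3_nilpotent_classification by blast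
next
  fix B C assume "B \<in> L2_twists" "C \<in> L2_twists" "r3_isomorphic B C"
  then show "B = C" by (rule L2_twists_isomorphic_imp_eq)
next
  fix B C assume "B \<in> L2_twists" "B = C"
  moreover obtain u v b c where "B = (*v) (twist u v 0 b c 0)"
    using L2_twists_is_twist[OF \<open>B \<in> L2_twists\<close>] by blast
  ultimately show "r3_isomorphic B C"
    by (auto intro!: twist_isomorphicI[where p = 1 and q = 0 and s = 0 and t = 0])
qed

end
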